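(* Let $n\ge 1$ and $m\ge 1$ be integers, and let $G$ be a finite region-connected $n$-simplex graph with chromatic number $\chi(G)=n+1$. Let $v=|V(G)|$ and let $r$ be the number of $n$-simplexes of $G$. Let $L_1,L_2:V(G)\to\mathbb{Z}/m\mathbb{Z}$ be labelings such that $L_1$ can be changed into $L_2$ by pushes. Then the number of different solutions changing $L_1$ into $L_2$ is exactly $m^{\,r-v+n}$.
   Context: Simplicial complex: a simplicial complex on a finite vertex set $V$ is a collection $\Delta$ of subsets of $V$ with $\{v\}\in\Delta$ for all $v\in V$ and such that $F\in\Delta$, $H\subseteq F$ imply $H\in\Delta$. A $k$-simplex is a member of $\Delta$ with exactly $k+1$ vertices. $n$-simplex graph: a simplicial complex $G$ such that for every $F\in G$ with $|F|<n+1$ there is $K\in G$ with $F\subsetneq K$. (Equivalently viewed as a graph: a union of complete graphs on $n+1$ vertices.) Its vertices are $V(G)$, its edges are its $1$-simplexes, and $\chi(G)$ is the chromatic number of the graph so obtained. The $n$-simplexes of $G$ are called its regions; $R(G)$ denotes the set of regions. Region-connectedness: two $n$-simplexes are adjacent if their intersection is an $(n-1)$-simplex (they share exactly $n$ vertices). A region-path from $S$ to $S'$ is a finite sequence of $n$-simplexes starting at $S$ and ending at $S'$ in which consecutive ones are adjacent. $G$ is region-connected if any two of its $n$-simplexes are joined by a region-path. Labelings and pushes: a labeling of $G$ is a map $L:V(G)\to\mathbb{Z}/m\mathbb{Z}$. For an $n$-simplex $S$ of $G$, the push on $S$ is the operation on labelings that adds $1$ (mod $m$) to the label of each vertex of $S$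 and leaves all other labels unchanged. Counting solutions: pushes commute and performing the same push $m$ times does nothing, so a set of moves is recorded by how many times (mod $m$) each region is pushed, i.e. by a function $a:R(G)\to\mathbb{Z}/m\mathbb{Z}$; there are $m^r$ such sets of moves. A solution changing $L_1$ into $L_2$ is such a function $a$ with $L_1(x)+\sum_{S\in R(G),\,x\in S}a(S)=L_2(x)$ in $\mathbb{Z}/m\mathbb{Z}$ for all $x\in V(G)$. *)

theory Defs
  imports Complex_Main "HOL-Library.FuncSet" "HOL-Number_Theory.Cong"
begin

definition simplicial_complex :: "'a set \<Rightarrow> 'a set set \<Rightarrow> bool" where
  "simplicial_complex V G \<longleftrightarrow>
     finite V \<and> G \<subseteq> Pow V \<and> (\<forall>v\<in>V. {v} \<in> G) \<and> (\<forall>F\<in>G. \<forall>H. H \<subseteq> F \<longrightarrow> H \<in> G)"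

definition simplexes :: "nat \<Rightarrow> 'a set set \<Rightarrow> 'a set set" where
  "simplexes k G = {F \<in> G. card F = k + 1}"

definition simplex_graph :: "nat \<Rightarrow> 'a set \<Rightarrow> 'a set set \<Rightarrow> bool" where
  "simplex_graph n V G \<longleftrightarrow>
     simplicial_complex V G \<and> (\<forall>F\<in>G. card F < n + 1 \<longrightarrow> (\<exists>K\<in>G. F \<subset> K))"

abbreviation regions :: "nat \<Rightarrow> 'a set set \<Rightarrow> 'a set set" where
  "regions n G \<equiv> simplexes n G"

definition edges :: "'a set set \<Rightarrow> 'a set set" where
  "edges G = simplexes 1 G"

definition proper_coloring :: "'a set \<Rightarrow> 'a set set \<Rightarrow> nat \<Rightarrow> ('a \<Rightarrow> nat) \<Rightarrow> bool" where
  "proper_coloring V G k c \<longleftrightarrow>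
     (\<forall>x\<in>V. c x < k) \<and> (\<forall>x y. {x, y} \<in> edges G \<longrightarrow> c x \<noteq> c y)"

definition chromatic_number :: "'a set \<Rightarrow> 'a set set \<Rightarrow> nat" where
  "chromatic_number V G = (LEAST k. \<exists>c. proper_coloring V G k c)"

text \<open>Natural subtraction: adjacency is only meant for \<open>n \<ge> 1\<close>.\<close>

definition adjacent_regions :: "nat \<Rightarrow> 'a set set \<Rightarrow> 'a set \<Rightarrow> 'a set \<Rightarrow> bool" where
  "adjacent_regions n G S T \<longleftrightarrow>
     S \<in> regions n G \<and> T \<in> regions n G \<and> S \<inter> T \<in> simplexes (n - 1) G"

definition region_path :: "nat \<Rightarrow> 'a set set \<Rightarrow> 'a set \<Rightarrow> 'a set list \<Rightarrow> 'a set \<Rightarrow> bool" where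
  "region_path n G S p T \<longleftrightarrow>
     p \<noteq> [] \<and> set p \<subseteq> regions n G \<and> hd p = S \<and> last p = T \<and>
     successively (adjacent_regions n G) p"

definition region_connected :: "nat \<Rightarrow> 'a set set \<Rightarrow> bool" where
  "region_connected n G \<longleftrightarrow>
     (\<forall>S\<in>regions n G. \<forall>T\<in>regions n G. \<exists>p. region_path n G S p T)"

text \<open>
  Residues modulo \<open>m\<close> are represented by the integers in \<open>{0..<m}\<close>, and maps defined on a set
  by extensional functions, so that equality and cardinality of maps are the usual ones.
\<close>

definition labelings :: "nat \<Rightarrow> 'a set \<Rightarrow> ('a \<Rightarrow> int) set" where
  "labelings m V = V \<rightarrow>\<^sub>E {0..<int m}"

definition push :: "nat \<Rightarrow> 'a set \<Rightarrow> ('a \<Rightarrow> int) \<Rightarrow> 'a \<Rightarrow> int" where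
  "push m S L = (\<lambda>x. if x \<in> S then (L x + 1) mod int m else L x)"

definition reachable_by_pushes ::
    "nat \<Rightarrow> nat \<Rightarrow> 'a set set \<Rightarrow> ('a \<Rightarrow> int) \<Rightarrow> ('a \<Rightarrow> int) \<Rightarrow> bool" where
  "reachable_by_pushes m n G = (\<lambda>L L'. \<exists>S\<in>regions n G. L' = push m S L)\<^sup>*\<^sup>*"

definition solutions ::
    "nat \<Rightarrow> nat \<Rightarrow> 'a set \<Rightarrow> 'a set set \<Rightarrow> ('a \<Rightarrow> int) \<Rightarrow> ('a \<Rightarrow> int) \<Rightarrow> ('a set \<Rightarrow> int) set" where
  "solutions m n V G L\<^sub>1 L\<^sub>2 =
     {a \<in> regions n G \<rightarrow>\<^sub>E {0..<int m}.
        \<forall>x\<in>V. [L\<^sub>1 x + (\<Sum>S | S \<in> regions n G \<and> x \<in> S. a S) = L\<^sub>2 x] (mod int m)}"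

end

theory Submission
  imports Defs
begin

text \<open>
  Fix a proper coloring with \<open>n + 1\<close> colors, a region \<open>S\<^sub>0\<close> and \<open>s \<in> S\<^sub>0\<close>, and let
  \<open>W = V - (S\<^sub>0 - {s})\<close>, which has \<open>v - n\<close> elements. Every region contains exactly one vertex of
  each color, so the total change over a color class does not depend on the color; hence a set of
  moves with no effect on \<open>W\<close> has no effect at all, and only the \<open>v - n\<close> congruences
  at the vertices of \<open>W\<close> matter. These are independent: pushing a region and undoing the push of an
  adjacent one moves a unit between two vertices of the same color, so along region-paths a unit
  can be moved from any vertex to the vertex of \<open>S\<^sub>0\<close> of the same color, and the push on \<open>S\<^sub>0\<close>
  changes only \<open>s\<close> within \<open>W\<close>. So the \<open>m\<^sup>r\<close> sets of moves split into \<open>m\<close> to the power \<open>v - n\<close>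
  fibers of equal size.
\<close>

section \<open>Counting solutions of linear congruences modulo \<open>m\<close>\<close>

text \<open>Since \<open>unit\<close> makes every unit vector attainable modulo \<open>m\<close>,
  every right-hand side is attainable. Translation by a suitable vector carries the solutions for
  one right-hand side injectively to those for another, so all the \<open>m ^ card W\<close> fibers
  have the same size.\<close>

lemma card_linear_congruence_solutions:
  fixes M :: "'r \<Rightarrow> 'w \<Rightarrow> int"
  assumes R: "finite R" and W: "finite W" and m: "m \<ge> 1"
    and unit: "\<And>w. w \<in> W \<Longrightarrow> \<exists>a. \<forall>x\<in>W. [(\<Sum>S\<in>R. a S * M S x) = of_bool (x = w)] (mod int m)"
  shows "card {a \<in> R \<rightarrow>\<^sub>E {0..<int m}. \<forall>x\<in>W. [(\<Sum>S\<in>R. a S * M S x) = f x] (mod int m)}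
           * m ^ card W = m ^ card R"
proof -
  define A where "A = R \<rightarrow>\<^sub>E {0..<int m}"
  define B where "B a x = (\<Sum>S\<in>R. a S * M S x)" for a x
  define F where "F g = {a \<in> A. \<forall>x\<in>W. [B a x = g x] (mod int m)}" for g :: "'w \<Rightarrow> int"
  have finA: "finite A" and cardA: "card A = m ^ card R"
    using R by (simp_all add: A_def finite_PiE card_funcsetE)
  have finF: "finite (F g)" for g
    using finA by (simp add: F_def)
  have onto: "\<exists>b. \<forall>x\<in>W. [B b x = g x] (mod int m)" for g
  proof -
    obtain u where u: "\<And>w x. w \<in> W \<Longrightarrow> x \<in> W \<Longrightarrow> [B (u w) x = of_bool (x = w)] (mod int m)"
      using unit unfolding B_def by metis
    \<comment> \<open>Superposition of the preimages of the unit vectors, weighted by the target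
      \<open>g\<close>.\<close>
    define b where "b S = (\<Sum>w\<in>W. g w * u w S)" for S
    have "[B b x = g x] (mod int m)" if x: "x \<in> W" for x
    proof -
      have "B b x = (\<Sum>w\<in>W. g w * B (u w) x)"
        unfolding B_def b_def sum_distrib_right sum_distrib_left
        by (subst sum.swap) (simp add: mult.assoc)
      also have "[\<dots> = (\<Sum>w\<in>W. g w * of_bool (x = w))] (mod int m)"
        using u x by (intro cong_sum cong_mult) auto
      also have "(\<Sum>w\<in>W. g w * of_bool (x = w)) = g x"
        using W x by (simp add: of_bool_def if_distrib cong: if_cong)
      finally show ?thesis .
    qed
    then show ?thesis by blast
  qed
  have le: "card (F g) \<le> card (F h)" for g h
  proof -
    obtain b where b: "\<And>x. x \<in> W \<Longrightarrow> [B b x = h x - g x] (mod int m)"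
      using onto[of "\<lambda>x. h x - g x"] by blast
    \<comment> \<open>Translation by \<open>b\<close>, reduced pointwise to return to the
      representatives that make up \<open>A\<close>.\<close>
    define t where "t a = (\<lambda>S\<in>R. (a S + b S) mod int m)" for a
    have "inj_on t (F g)"
    proof (rule inj_onI)
      fix a a' assume a: "a \<in> F g" and a': "a' \<in> F g" and eq: "t a = t a'"
      have A: "a \<in> A" "a' \<in> A" using a a' by (simp_all add: F_def)
      show "a = a'"
      proof (rule PiE_ext[OF A[unfolded A_def]])
        fix S assume S: "S \<in> R"
        have "(a S + b S) mod int m = (a' S + b S) mod int m"
          using fun_cong[OF eq, of S] S by (simp add: t_def)
        then have "[a S + b S = a' S + b S] (mod int m)"
          by (simp add: cong_def)
        then have "[a S = a' S] (mod int m)"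
          by (simp add: cong_add_rcancel)
        moreover have "a S \<in> {0..<int m}" "a' S \<in> {0..<int m}"
          using A S by (auto simp: A_def)
        ultimately show "a S = a' S"
          by (simp add: cong_def)
      qed
    qed
    moreover have "t ` F g \<subseteq> F h"
    proof (rule image_subsetI)
      fix a assume a: "a \<in> F g"
      have "t a \<in> A" using m by (auto simp: t_def A_def)
      moreover have "[B (t a) x = h x] (mod int m)" if x: "x \<in> W" for x
      proof -
        have "[B (t a) x = (\<Sum>S\<in>R. (a S + b S) * M S x)] (mod int m)"
          unfolding B_def by (intro cong_sum cong_mult) (auto simp: t_def cong_def)
        also have "(\<Sum>S\<in>R. (a S + b S) * M S x) = B a x + B b x"
          by (simp add: B_def sum.distrib distrib_right)
        also have "[B a x + B b x = g x + (h x - g x)] (mod int m)"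
          using a b x by (intro cong_add) (auto simp: F_def)
        finally show ?thesis by simp
      qed
      ultimately show "t a \<in> F h" by (simp add: F_def)
    qed
    ultimately show ?thesis
      using finF by (rule card_inj_on_le)
  qed
  \<comment> \<open>One right-hand side for each vector of residues. The given \<open>f\<close> may
    lie outside \<open>P\<close>, which is harmless because \<open>le\<close> compares fibers over
    arbitrary integer right-hand sides.\<close>
  define P where "P = W \<rightarrow>\<^sub>E {0..<int m}"
  have A_eq: "A = (\<Union>g\<in>P. F g)"
  proof
    show "A \<subseteq> (\<Union>g\<in>P. F g)"
    proof
      fix a assume a: "a \<in> A"
      have "(\<lambda>x\<in>W. B a x mod int m) \<in> P" using m by (auto simp: P_def)
      moreover have "a \<in> F (\<lambda>x\<in>W. B a x mod int m)"
        using a by (auto simp: F_def cong_def)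
      ultimately show "a \<in> (\<Union>g\<in>P. F g)" by blast
    qed
  qed (auto simp: F_def)
  have disj: "F g \<inter> F h = {}" if g: "g \<in> P" and h: "h \<in> P" and ne: "g \<noteq> h" for g h
  proof (rule ccontr)
    assume "F g \<inter> F h \<noteq> {}"
    then have cong: "[g x = h x] (mod int m)" if "x \<in> W" for x
      using that unfolding F_def by (blast intro: cong_sym cong_trans)
    have "g x = h x" if x: "x \<in> W" for x
    proof -
      have "g x \<in> {0..<int m}" "h x \<in> {0..<int m}"
        using g h x by (auto simp: P_def)
      then show ?thesis using cong[OF x] by (simp add: cong_def)
    qed
    then have "g = h" using g h unfolding P_def by (intro PiE_ext)
    then show False using ne by simp
  qed
  have finP: "finite P" and cardP: "card P = m ^ card W"
    using W by (simp_all add: P_def finite_PiE card_funcsetE)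
  have "card A = (\<Sum>g\<in>P. card (F g))"
    unfolding A_eq using finP finF disj by (intro card_UN_disjoint) auto
  also have "\<dots> = (\<Sum>g\<in>P. card (F f))"
    using le by (intro sum.cong refl antisym)
  finally show ?thesis
    using cardA cardP by (simp add: F_def A_def B_def mult.commute)
qed

section \<open>Paths as reachability, and existence of an optimal coloring\<close>

lemma successively_imp_rtranclp:
  "successively P xs \<Longrightarrow> xs \<noteq> [] \<Longrightarrow> P\<^sup>*\<^sup>* (hd xs) (last xs)"
proof (induction xs rule: induct_list012)
  case (3 x y zs)
  then have "P x y" "P\<^sup>*\<^sup>* y (last (y # zs))" by auto
  then show ?case by (auto intro: converse_rtranclp_into_rtranclp)
qed auto

text \<open>An injective numbering of \<open>V\<close> is a proper coloring, so some number of
  colors is admissible and the \<open>LEAST\<close> is attained.\<close>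

lemma chromatic_number_coloring:
  assumes "simplicial_complex V G"
  shows "\<exists>c. proper_coloring V G (chromatic_number V G) c"
proof -
  have fin: "finite V" and sub: "G \<subseteq> Pow V"
    using assms by (auto simp: simplicial_complex_def)
  obtain f where f: "bij_betw f V {0..<card V}"
    using ex_bij_betw_finite_nat[OF fin] by blast
  have "proper_coloring V G (card V) f"
    unfolding proper_coloring_def
  proof (intro conjI ballI allI impI)
    fix x assume "x \<in> V"
    then show "f x < card V" using f by (auto dest: bij_betwE)
  next
    fix x y assume e: "{x, y} \<in> edges G"
    then have "x \<noteq> y" by (auto simp: edges_def simplexes_def)
    moreover have "x \<in> V" "y \<in> V" using e sub by (auto simp: edges_def simplexes_def)
    ultimately show "f x \<noteq> f y" using f by (auto simp: bij_betw_def inj_on_def)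
  qed
  then show ?thesis
    unfolding chromatic_number_def
    by (intro LeastI[of "\<lambda>k. \<exists>c. proper_coloring V G k c"] exI)
qed

section \<open>The effect of a set of moves on the labels\<close>

text \<open>Integer coefficients without reduction allow pushes to be undone and identities to hold
  exactly. The indicator factor makes this the product with the incidence matrix, the form that the
  counting lemma expects.\<close>

definition total_push :: "nat \<Rightarrow> 'a set set \<Rightarrow> ('a set \<Rightarrow> int) \<Rightarrow> 'a \<Rightarrow> int" where
  "total_push n G a x = (\<Sum>S\<in>regions n G. a S * of_bool (x \<in> S))"

lemma total_push_add: "total_push n G (\<lambda>S. a S + b S) x = total_push n G a x + total_push n G b x"
  by (simp add: total_push_def sum.distrib distrib_right)

lemma total_push_diff: "total_push n G (\<lambda>S. a S - b S) x = total_push n G a x - total_push n G b x"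
  by (simp add: total_push_def sum_subtractf left_diff_distrib)

lemma total_push_single:
  assumes "finite G" "T \<in> regions n G"
  shows "total_push n G (\<lambda>S. of_bool (S = T)) x = of_bool (x \<in> T)"
proof -
  have "finite (regions n G)" using assms by (simp add: simplexes_def)
  then show ?thesis
    using assms(2) by (simp add: total_push_def of_bool_def if_distrib[of "\<lambda>t. t * _"] cong: if_cong)
qed

lemma sum_regions_containing:
  assumes "finite G"
  shows "(\<Sum>S | S \<in> regions n G \<and> x \<in> S. a S) = total_push n G a x"
proof -
  have "finite (regions n G)" using assms by (simp add: simplexes_def)
  then show ?thesis
    by (simp add: total_push_def of_bool_def if_distrib[of "(*) _"] sum.inter_filter cong: if_cong)
qed

text \<open>Supplies a particular solution, by which the congruences are later made
  homogeneous.\<close>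

lemma reachable_imp_total_push:
  assumes "finite G" "reachable_by_pushes m n G L L'"
  shows "\<exists>a. \<forall>x. [L x + total_push n G a x = L' x] (mod int m)"
  using assms(2) unfolding reachable_by_pushes_def
proof (induction rule: rtranclp_induct)
  case base
  have "[L x + total_push n G (\<lambda>_. 0) x = L x] (mod int m)" for x
    by (simp add: total_push_def)
  then show ?case by blast
next
  case (step L' L'')
  then obtain a S where a: "\<And>x. [L x + total_push n G a x = L' x] (mod int m)"
    and S: "S \<in> regions n G" and L'': "L'' = push m S L'" by blast
  have "[L x + total_push n G (\<lambda>T. a T + of_bool (T = S)) x = L'' x] (mod int m)" for x
  proof -
    have "[L x + total_push n G a x + of_bool (x \<in> S) = L' x + of_bool (x \<in> S)] (mod int m)"
      using a by (simp add: cong_add_rcancel)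
    also have "[L' x + of_bool (x \<in> S) = L'' x] (mod int m)"
      by (simp add: L'' push_def cong_def)
    finally show ?thesis
      by (simp add: total_push_add total_push_single[OF assms(1) S] add.assoc)
  qed
  then show ?case by blast
qed

section \<open>Colors of regions and moves along region-paths\<close>

locale colored_simplex_graph =
  fixes n :: nat and V :: "'a set" and G :: "'a set set" and c :: "'a \<Rightarrow> nat"
  assumes n: "n \<ge> 1"
    and graph: "simplex_graph n V G"
    and connected: "region_connected n G"
    and coloring: "proper_coloring V G (n + 1) c"
begin

lemma finite_V: "finite V" and simplex_subset: "F \<in> G \<Longrightarrow> F \<subseteq> V"
  and vertex_simplex: "x \<in> V \<Longrightarrow> {x} \<in> G"
  and simplex_mono: "F \<in> G \<Longrightarrow> H \<subseteq> F \<Longrightarrow> H \<in> G"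
  using graph by (auto simp: simplex_graph_def simplicial_complex_def)

lemma finite_G: "finite G"
  using finite_V simplex_subset by (auto intro: finite_subset[of G "Pow V"])

lemma finite_simplex: "F \<in> G \<Longrightarrow> finite F"
  using finite_V simplex_subset finite_subset by blast

lemma inj_on_simplex: assumes "F \<in> G" shows "inj_on c F"
proof (rule inj_onI, rule ccontr)
  fix x y assume "x \<in> F" "y \<in> F" and eq: "c x = c y" and ne: "x \<noteq> y"
  then have "{x, y} \<in> edges G"
    using simplex_mono[OF assms, of "{x, y}"] by (auto simp: edges_def simplexes_def)
  then show False using coloring eq by (auto simp: proper_coloring_def)
qed

lemma colors_simplex: "F \<in> G \<Longrightarrow> c ` F \<subseteq> {..<n + 1}"
  using coloring simplex_subset by (fastforce simp: proper_coloring_def)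

lemma card_simplex_le: assumes "F \<in> G" shows "card F \<le> n + 1"
  using card_inj_on_le[OF inj_on_simplex colors_simplex, of F] assms by simp

lemma colors_region: assumes "S \<in> regions n G" shows "c ` S = {..<n + 1}"
proof (rule card_subset_eq)
  show "c ` S \<subseteq> {..<n + 1}" "card (c ` S) = card {..<n + 1}"
    using assms colors_simplex[of S] by (simp_all add: simplexes_def card_image[OF inj_on_simplex])
qed simp

lemma region_color_ex1:
  assumes "S \<in> regions n G" "i < n + 1"
  shows "\<exists>!x. x \<in> S \<and> c x = i"
proof -
  have "i \<in> c ` S" using assms colors_region by auto
  moreover have "inj_on c S" using assms inj_on_simplex by (simp add: simplexes_def)
  ultimately show ?thesis by (auto simp: inj_on_def)
qed

text \<open>A maximal simplex through \<open>x\<close> has at least \<open>n + 1\<close> vertices by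
  the extension property, and at most \<open>n + 1\<close> because its vertices have distinct
  colors.\<close>

lemma vertex_in_region: assumes "x \<in> V" shows "\<exists>S\<in>regions n G. x \<in> S"
proof -
  have "{F \<in> G. x \<in> F} \<noteq> {}" "finite {F \<in> G. x \<in> F}"
    using vertex_simplex[OF assms] finite_G by auto
  then obtain F where F: "F \<in> G" "x \<in> F"
    and max: "\<And>K. K \<in> G \<Longrightarrow> x \<in> K \<Longrightarrow> F \<subseteq> K \<Longrightarrow> F = K"
    using finite_has_maximal[of "{F \<in> G. x \<in> F}"] by auto
  have "\<not> card F < n + 1"
    using graph F max by (auto simp: simplex_graph_def)
  then have "card F = n + 1" using card_simplex_le[OF F(1)] by simp
  then show ?thesis using F by (auto simp: simplexes_def)
qed

text \<open>After exchanging the sums, each region contributes its coefficient exactly once, through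
  its only vertex of color \<open>i\<close>.\<close>

lemma sum_color_class:
  assumes "i < n + 1"
  shows "(\<Sum>x | x \<in> V \<and> c x = i. total_push n G a x) = (\<Sum>S\<in>regions n G. a S)"
proof -
  have "(\<Sum>x | x \<in> V \<and> c x = i. of_bool (x \<in> S)) = (1 :: int)" if S: "S \<in> regions n G" for S
  proof -
    obtain y where y: "y \<in> S" "c y = i" "\<And>x. x \<in> S \<Longrightarrow> c x = i \<Longrightarrow> x = y"
      using region_color_ex1[OF S assms] by blast
    have "y \<in> V" using y(1) S simplex_subset[of S] by (auto simp: simplexes_def)
    have "(\<Sum>x | x \<in> V \<and> c x = i. of_bool (x \<in> S))
        = (\<Sum>x | x \<in> V \<and> c x = i. if x = y then 1 else 0 :: int)"
      using y(1,2) by (intro sum.cong) (auto dest: y(3))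
    also have "\<dots> = 1" using \<open>y \<in> V\<close> y(2) finite_V by simp
    finally show ?thesis .
  qed
  then show ?thesis
    unfolding total_push_def
    by (subst sum.swap) (simp flip: sum_distrib_left)
qed

text \<open>Induction along a region-path from \<open>S\<close> to a region containing
  \<open>y\<close>. The vertex \<open>y\<close> stays general because the induction hypothesis is
  applied to another vertex of the same color.\<close>

lemma move_unit_to_region:
  assumes S: "S \<in> regions n G" and y: "y \<in> V" and z: "z \<in> S" and yz: "c y = c z"
  shows "\<exists>a. \<forall>x. total_push n G a x = of_bool (x = y) - of_bool (x = z)"
proof -
  obtain T where T: "T \<in> regions n G" "y \<in> T" using vertex_in_region[OF y] by blast
  obtain p where "region_path n G S p T"
    using connected S T by (auto simp: region_connected_def)
  then have "(adjacent_regions n G)\<^sup>*\<^sup>* S T"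
    using successively_imp_rtranclp[of "adjacent_regions n G" p] by (auto simp: region_path_def)
  then show ?thesis using T(2) yz
  proof (induction arbitrary: y rule: rtranclp_induct)
    case base
    then have "y = z"
      using S z inj_on_simplex[of S] by (auto simp: simplexes_def inj_on_def)
    moreover have "total_push n G (\<lambda>_. 0) x = 0" for x by (simp add: total_push_def)
    ultimately show ?case by (intro exI[of _ "\<lambda>_. 0"]) simp
  next
    case (step T T')
    have T: "T \<in> regions n G" and T': "T' \<in> regions n G" and I: "card (T \<inter> T') = n"
      using step.hyps n by (auto simp: adjacent_regions_def simplexes_def)
    show ?case
    proof (cases "y \<in> T")
      case True
      then show ?thesis using step by blast
    next
      case False
      have "c y < n + 1" using colors_region[OF T'] step.prems(1) by (metis imageI lessThan_iff)
      \<comment> \<open>By its color, \<open>u\<close> must be the vertex given up in passing from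
        \<open>T\<close> to \<open>T'\<close>, with \<open>y\<close> taking its place.\<close>
      then obtain u where u: "u \<in> T" "c u = c y" using region_color_ex1[OF T] by blast
      have "u \<notin> T'"
        using inj_onD[OF inj_on_simplex[of T'], of u y] T' u False step.prems(1)
        by (auto simp: simplexes_def)
      have fin: "finite T" "finite T'" and card: "card T = n + 1" "card T' = n + 1"
        using T T' finite_simplex by (auto simp: simplexes_def)
      have "T \<inter> T' = T - {u}"
        using fin card I u \<open>u \<notin> T'\<close> by (intro card_subset_eq) auto
      moreover have "T \<inter> T' = T' - {y}"
        using fin card I step.prems False by (intro card_subset_eq) auto
      ultimately have eq: "T - {u} = T' - {y}" by simp
      have diff: "of_bool (x \<in> T') - of_bool (x \<in> T) = (of_bool (x = y) - of_bool (x = u) :: int)" for x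
      proof -
        have "x \<in> T \<and> x \<noteq> u \<longleftrightarrow> x \<in> T' \<and> x \<noteq> y" using eq by blast
        then show ?thesis using u False \<open>u \<notin> T'\<close> step.prems(1) by auto
      qed
      obtain a where a: "\<And>x. total_push n G a x = of_bool (x = u) - of_bool (x = z)"
        using step.IH[of u] u step.prems by auto
      \<comment> \<open>Pushing \<open>T'\<close> and undoing the push on \<open>T\<close> cancels
        the unit at \<open>u\<close> and creates one at \<open>y\<close>.\<close>
      have "total_push n G (\<lambda>K. a K + (of_bool (K = T') - of_bool (K = T))) x
          = of_bool (x = y) - of_bool (x = z)" for x
        by (simp add: total_push_add total_push_diff total_push_single[OF finite_G] T T' a diff)
      then show ?thesis by blast
    qed
  qed
qed

section \<open>Independence and sufficiency of the congruences on \<open>W\<close>\<close>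

context
  fixes S :: "'a set" and s :: 'a and W :: "'a set"
  assumes S: "S \<in> regions n G" and s: "s \<in> S"
  defines "W \<equiv> V - (S - {s})"
begin

lemma card_W: "int (card W) = int (card V) - int n"
proof -
  have "S \<subseteq> V" "finite S" "card S = n + 1"
    using S simplex_subset finite_simplex by (auto simp: simplexes_def)
  moreover from this have "card (S - {s}) = n" "card S \<le> card V"
    using s finite_V card_mono[of V S] by simp_all
  moreover have "card W = card V - card (S - {s})"
    unfolding W_def using \<open>S \<subseteq> V\<close> \<open>finite S\<close> by (intro card_Diff_subset) auto
  ultimately show ?thesis by simp
qed

text \<open>Moving a unit between \<open>w\<close> and the vertex \<open>z\<close> of
  \<open>S\<close> with its color leaves an unwanted -1 at \<open>z\<close>. Either \<open>z\<close>
  lies outside \<open>W\<close>, or \<open>z = s\<close> and a push on \<open>S\<close> repairs it,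
  since \<open>S\<close> meets \<open>W\<close> only in \<open>s\<close>.\<close>

lemma total_push_unit:
  assumes "w \<in> W"
  shows "\<exists>a. \<forall>x\<in>W. total_push n G a x = of_bool (x = w)"
proof -
  have s_unit: "total_push n G (\<lambda>K. of_bool (K = S)) x = of_bool (x = s)" if "x \<in> W" for x
  proof -
    have "x \<in> S \<longleftrightarrow> x = s" using that s unfolding W_def by blast
    then show ?thesis by (simp add: total_push_single[OF finite_G S])
  qed
  have w: "w \<in> V" using assms by (simp add: W_def)
  have "c w < n + 1" using coloring w by (simp add: proper_coloring_def)
  then obtain z where z: "z \<in> S" "c w = c z" using region_color_ex1[OF S] by metis
  obtain a where a: "\<And>x. total_push n G a x = of_bool (x = w) - of_bool (x = z)"
    using move_unit_to_region[OF S w z] by blast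
  show ?thesis
  proof (cases "z = s")
    case True
    have "total_push n G (\<lambda>K. a K + of_bool (K = S)) x = of_bool (x = w)" if "x \<in> W" for x
      using a s_unit[OF that] True by (simp add: total_push_add)
    then show ?thesis by blast
  next
    case False
    then have "total_push n G a x = of_bool (x = w)" if "x \<in> W" for x
      using that z a by (auto simp: W_def)
    then show ?thesis by blast
  qed
qed

lemma total_push_cong_0_extend:
  assumes zero: "\<And>x. x \<in> W \<Longrightarrow> [total_push n G a x = 0] (mod k)" and y: "y \<in> V"
  shows "[total_push n G a y = 0] (mod k)"
proof (cases "y \<in> W")
  case False
  then have yS: "y \<in> S" using y by (simp add: W_def)
  have inj: "inj_on c S" using S inj_on_simplex by (simp add: simplexes_def)
  have sV: "s \<in> V" using S s simplex_subset by (auto simp: simplexes_def)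
  let ?C = "\<lambda>i. {x. x \<in> V \<and> c x = i}"
  have fin: "finite (?C i)" for i using finite_V by simp
  have lt: "c y < n + 1" "c s < n + 1" using coloring y sV by (simp_all add: proper_coloring_def)
  \<comment> \<open>The other vertices of \<open>S\<close> differ in color from \<open>s\<close>, so
    this class avoids the removed vertices and shows that the coefficients of \<open>a\<close> sum
    to 0 modulo \<open>k\<close>.\<close>
  have "?C (c s) \<subseteq> W" using inj s by (auto simp: W_def inj_on_def)
  then have "[(\<Sum>x\<in>?C (c s). total_push n G a x) = (\<Sum>x\<in>?C (c s). 0)] (mod k)"
    using zero by (intro cong_sum) auto
  then have total: "[(\<Sum>K\<in>regions n G. a K) = 0] (mod k)"
    using sum_color_class[OF lt(2), of a] by simp
  \<comment> \<open>In the class of \<open>y\<close> only \<open>y\<close> itself was removed, so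
    its change is determined by the class total and the vanishing changes at the others.\<close>
  have "?C (c y) - {y} \<subseteq> W" using inj yS by (auto simp: W_def inj_on_def)
  then have "[(\<Sum>x\<in>?C (c y) - {y}. total_push n G a x) = (\<Sum>x\<in>?C (c y) - {y}. 0)] (mod k)"
    using zero by (intro cong_sum) auto
  then have rest: "[(\<Sum>x\<in>?C (c y) - {y}. total_push n G a x) = 0] (mod k)" by simp
  have "total_push n G a y
      = (\<Sum>K\<in>regions n G. a K) - (\<Sum>x\<in>?C (c y) - {y}. total_push n G a x)"
    using sum_color_class[OF lt(1), of a] sum.remove[OF fin, of y "c y" "total_push n G a"] y
    by simp
  then show ?thesis using cong_diff[OF total rest] by simp
qed (use zero in simp)

end

section \<open>The number of solutions\<close>

lemma card_solutions:
  assumes m: "m \<ge> 1" and reach: "reachable_by_pushes m n G L L'" and ne: "V \<noteq> {}"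
  shows "real (card (solutions m n V G L L'))
    = real m powi (int (card (regions n G)) - int (card V) + int n)"
proof -
  obtain S s where S: "S \<in> regions n G" and s: "s \<in> S"
    using ne vertex_in_region by blast
  define W where "W = V - (S - {s})"
  obtain b where b: "\<And>x. [L x + total_push n G b x = L' x] (mod int m)"
    using reachable_imp_total_push[OF finite_G reach] by blast
  \<comment> \<open>Subtracting the particular solution \<open>b\<close> gives a homogeneous system,
    to which the extension from \<open>W\<close> to \<open>V\<close> applies.\<close>
  have iff: "[L x + total_push n G a x = L' x] (mod int m)
      \<longleftrightarrow> [total_push n G (\<lambda>K. a K - b K) x = 0] (mod int m)" for a x
  proof -
    have "[L x + total_push n G a x = L' x] (mod int m)
        \<longleftrightarrow> [L x + total_push n G a x = L x + total_push n G b x] (mod int m)"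
      using b[of x] by (meson cong_sym cong_trans)
    also have "\<dots> \<longleftrightarrow> [total_push n G a x = total_push n G b x] (mod int m)"
      by (rule cong_add_lcancel)
    also have "\<dots> \<longleftrightarrow> [total_push n G (\<lambda>K. a K - b K) x = 0] (mod int m)"
      by (simp add: total_push_diff cong_iff_dvd_diff)
    finally show ?thesis .
  qed
  have only_W: "(\<forall>x\<in>V. [L x + total_push n G a x = L' x] (mod int m))
      \<longleftrightarrow> (\<forall>x\<in>W. [L x + total_push n G a x = L' x] (mod int m))" for a
    unfolding iff using total_push_cong_0_extend[OF S s, of "\<lambda>K. a K - b K" "int m"]
    by (auto simp: W_def)
  have shift: "[L x + t = L' x] (mod int m) \<longleftrightarrow> [t = L' x - L x] (mod int m)" for x t
    by (simp add: cong_iff_dvd_diff algebra_simps)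
  have "solutions m n V G L L' = {a \<in> regions n G \<rightarrow>\<^sub>E {0..<int m}.
      \<forall>x\<in>W. [(\<Sum>K\<in>regions n G. a K * of_bool (x \<in> K)) = L' x - L x] (mod int m)}"
    unfolding solutions_def sum_regions_containing[OF finite_G] only_W
    by (simp only: shift total_push_def)
  moreover have "card \<dots> * m ^ card W = m ^ card (regions n G)"
  proof (rule card_linear_congruence_solutions)
    show "finite (regions n G)" using finite_G by (simp add: simplexes_def)
    show "finite W" using finite_V by (simp add: W_def)
    show "\<exists>a. \<forall>x\<in>W. [(\<Sum>K\<in>regions n G. a K * of_bool (x \<in> K)) = of_bool (x = w)] (mod int m)"
      if "w \<in> W" for w
      using total_push_unit[OF S s, of w] that unfolding W_def total_push_def
      by (metis cong_refl)
  qed (rule m)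
  ultimately have "real (card (solutions m n V G L L')) * real m ^ card W = real m ^ card (regions n G)"
    by (metis of_nat_mult of_nat_power)
  then have "real (card (solutions m n V G L L'))
      = real m powi int (card (regions n G)) / real m powi int (card W)"
    using m by (simp add: field_simps)
  also have "\<dots> = real m powi (int (card (regions n G)) - int (card W))"
    using m by (simp add: power_int_diff)
  also have "int (card (regions n G)) - int (card W) = int (card (regions n G)) - int (card V) + int n"
    using card_W[OF S s] by (simp add: W_def)
  finally show ?thesis .
qed

end

theorem theorem5p10:
  fixes n m v r :: nat and V :: "'a set" and G :: "'a set set" and L\<^sub>1 L\<^sub>2 :: "'a \<Rightarrow> int"
  assumes "n \<ge> 1" and "m \<ge> 1"
    and "simplex_graph n V G"
    and "region_connected n G"
    and "chromatic_number V G = n + 1"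
    and "v = card V" and "r = card (regions n G)"
    and "L\<^sub>1 \<in> labelings m V" and "L\<^sub>2 \<in> labelings m V"
    and "reachable_by_pushes m n G L\<^sub>1 L\<^sub>2"
  shows "real (card (solutions m n V G L\<^sub>1 L\<^sub>2)) = real m powi (int r - int v + int n)"
proof -
  have complex: "simplicial_complex V G" using assms(3) by (simp add: simplex_graph_def)
  obtain c where "proper_coloring V G (n + 1) c"
    using chromatic_number_coloring[OF complex] assms(5) by auto
  then interpret colored_simplex_graph n V G c
    using assms by unfold_locales
  \<comment> \<open>This guarantees a region from which \<open>W\<close> can be built: an empty
    complex would need no colors, whereas \<open>n + 1\<close> is positive.\<close>
  have "V \<noteq> {}"
  proof
    assume V: "V = {}"
    then have "proper_coloring V G 0 c"
      using complex by (auto simp: proper_coloring_def edges_def simplexes_def simplicial_complex_def)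
    then have "chromatic_number V G \<le> 0"
      unfolding chromatic_number_def by (intro Least_le) blast
    then show False using assms(5) by simp
  qed
  then show ?thesis
    using card_solutions assms by simp
qed

end
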